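(* Let $A_k=k\cdot(k+1)\cdots(k+p)$ for $k\ge0$, and consequently $\gamma_k=\frac{A_{k+1}-A_k}{A_{k+1}}=\frac{p+1}{k+p+1}$. Then for all iterates $\{x_k\}_{k\ge1}$ of the Contracting-Point Tensor Method II (described in the context) with constant $c\ge 0$, we have $$F(x_k)-F^*\;\le\;\ell_k\;\le\;(p+1)^{p+1}\cdot\bigl(c+\Gamma^{(p)}_{\mathrm{dom}\,\psi}(f)\bigr)\cdot k^{-p},\qquad k\ge1,$$ where $\ell_k$ is the accuracy certificate $$\ell_k=F(x_k)-\frac1{A_k}\min_{v\in\mathrm{dom}\,\psi}\varphi_k(v),\qquad \varphi_k(v)=\sum_{i=1}^k a_i\bigl[f(\bar x_i)+\langle\nabla f(\bar x_i),v-\bar x_i\rangle+\psi(v)\bigr],\qquad a_i=A_i-A_{i-1}.$$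
   Context: Setting. $\mathbb{E}$ is a finite-dimensional real vector space with dual $\mathbb{E}^*$; $\langle s,x\rangle$ is the value of $s\in\mathbb{E}^*$ at $x\in\mathbb{E}$. The problem is $F^*=\min_{x\in\mathrm{dom}\,\psi}[F(x)=f(x)+\psi(x)]$, where $\psi:\mathbb{E}\to\mathbb{R}\cup\{+\infty\}$ is a proper closed convex function with bounded domain $\mathrm{dom}\,\psi=\{x:\psi(x)<+\infty\}$, and $f$ is convex and $p\ge 1$ times continuously differentiable at every point of $\mathrm{dom}\,\psi$. $D^if(x)[h]^i$ is the $i$th directional derivative of $f$ at $x$ along $h$ (repeated $i$ times), and $D^if(x)[h]^{i-1}\in\mathbb{E}^*$ denotes $\frac1i$ times the gradient in $h$ of $D^if(x)[h]^i$ (so $D^1f(x)[h]^0=\nabla f(x)$, $D^2f(x)[h]^1=\nabla^2f(x)h$). $\Omega_p(f,x_k;y)=f(x_k)+\sum_{i=1}^p\frac1{i!}D^if(x_k)[y-x_k]^i$ is the Taylor polynomial, and $\nabla\Omega_p(f,x_k;y)$ is its gradient with respect to $y$. Contracting-Point Tensor Method II. Choose $x_0\in\mathrm{dom}\,\psi$ and $c\ge 0$. At iteration $k\ge0$: (1) choose $\gamma_k\in(0,1]$; (2) for some $0\le\xi_{k+1}\le c\gamma_k^{p+1}$ find $\bar x_{k+1}=(1-\gamma_k)x_k+\gamma_k\bar v_{k+1}$ with $\bar v_{k+1}\in\mathrm{dom}\,\psi$ such that $$\langle\nabla\Omega_p(f,x_k;\bar x_{k+1}),v-\bar v_{k+1}\rangle+\psi(v)\ge\psi(\bar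 v_{k+1})-\tfrac1{\gamma_k}\xi_{k+1}\quad\text{for all }v\in\mathrm{dom}\,\psi;$$ (3) if $F(\bar x_{k+1})\le F(x_k)$ set $x_{k+1}=\bar x_{k+1}$, else set $x_{k+1}=x_k$. For a convex set $Q$, $$\Gamma^{(p)}_Q(f)=\sup_{x,y,v\in Q,\;t\in(0,1]}\frac1{t^p}\Bigl|\Bigl\langle\nabla f(x+t(v-x))-\nabla f(x)-\sum_{i=2}^{p}\frac{t^{i-1}}{(i-1)!}D^if(x)[v-x]^{i-1},\,v-y\Bigr\rangle\Bigr|\in[0,+\infty]$$ (the asserted upper bound is void if this quantity is $+\infty$). *)

theory Defs
  imports "HOL-Analysis.Analysis"
begin

text \<open>
  The space is a type of class \<open>euclidean_space\<close>; its inner product is never used.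
  The value of the covector \<open>\<nabla>f(x)\<close> at \<open>h\<close> is \<open>frechet_derivative f (at x) h\<close>.
\<close>

definition edom :: "('a \<Rightarrow> ereal) \<Rightarrow> 'a set" where
  "edom \<psi> = {x. \<psi> x < \<infinity>}"

definition epi :: "('a \<Rightarrow> ereal) \<Rightarrow> ('a \<times> real) set" where
  "epi \<psi> = {(x, r). \<psi> x \<le> ereal r}"

definition proper_closed_convex :: "('a::euclidean_space \<Rightarrow> ereal) \<Rightarrow> bool" where
  "proper_closed_convex \<psi> \<longleftrightarrow>
     (\<forall>x. \<psi> x \<noteq> - \<infinity>) \<and> edom \<psi> \<noteq> {} \<and> convex (epi \<psi>) \<and> closed (epi \<psi>)"

text \<open>On an open set of a finite-dimensional space the following is the usual class \<open>C\<^sup>n\<close>: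
  all iterated directional derivatives up to order \<open>n\<close> exist and are continuous.\<close>

primrec cont_diff_on :: "nat \<Rightarrow> ('a::euclidean_space \<Rightarrow> real) \<Rightarrow> 'a set \<Rightarrow> bool" where
  "cont_diff_on 0 f U \<longleftrightarrow> continuous_on U f"
| "cont_diff_on (Suc n) f U \<longleftrightarrow>
     (\<forall>x\<in>U. f differentiable (at x)) \<and>
     (\<forall>h. cont_diff_on n (\<lambda>x. frechet_derivative f (at x) h) U)"

definition cont_diff_at :: "nat \<Rightarrow> ('a::euclidean_space \<Rightarrow> real) \<Rightarrow> 'a \<Rightarrow> bool" where
  "cont_diff_at n f x \<longleftrightarrow> (\<exists>U. open U \<and> x \<in> U \<and> cont_diff_on n f U)"

text \<open>\<open>dir_deriv i f x h\<close> is \<open>D\<^sup>if(x)[h]\<^sup>i\<close>, and \<open>dual_deriv i f x h u\<close> is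
  \<open>\<langle>D\<^sup>if(x)[h]\<^sup>i\<^sup>-\<^sup>1, u\<rangle>\<close>, for \<open>i \<ge> 1\<close>.\<close>

primrec dir_deriv :: "nat \<Rightarrow> ('a::euclidean_space \<Rightarrow> real) \<Rightarrow> 'a \<Rightarrow> 'a \<Rightarrow> real" where
  "dir_deriv 0 f x h = f x"
| "dir_deriv (Suc i) f x h = dir_deriv i (\<lambda>y. frechet_derivative f (at y) h) x h"

definition dual_deriv :: "nat \<Rightarrow> ('a::euclidean_space \<Rightarrow> real) \<Rightarrow> 'a \<Rightarrow> 'a \<Rightarrow> 'a \<Rightarrow> real" where
  "dual_deriv i f x h u = (1 / real i) * frechet_derivative (\<lambda>h'. dir_deriv i f x h') (at h) u"

definition taylor_poly :: "nat \<Rightarrow> ('a::euclidean_space \<Rightarrow> real) \<Rightarrow> 'a \<Rightarrow> 'a \<Rightarrow> real" where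
  "taylor_poly p f x y = f x + (\<Sum>i=1..p. (1 / fact i) * dir_deriv i f x (y - x))"

definition Gamma_const :: "nat \<Rightarrow> 'a::euclidean_space set \<Rightarrow> ('a \<Rightarrow> real) \<Rightarrow> ereal" where
  "Gamma_const p Q f =
     (SUP (x, y, v, t) \<in> Q \<times> Q \<times> Q \<times> {0<..1::real}.
        ereal ((1 / t ^ p) *
          \<bar>frechet_derivative f (at (x + t *\<^sub>R (v - x))) (v - y)
            - frechet_derivative f (at x) (v - y)
            - (\<Sum>i=2..p. t ^ (i - 1) / fact (i - 1) * dual_deriv i f x (v - x) (v - y))\<bar>))"

definition F_obj :: "('a \<Rightarrow> real) \<Rightarrow> ('a \<Rightarrow> ereal) \<Rightarrow> 'a \<Rightarrow> ereal" where
  "F_obj f \<psi> x = ereal (f x) + \<psi> x"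

definition F_star :: "('a \<Rightarrow> real) \<Rightarrow> ('a \<Rightarrow> ereal) \<Rightarrow> ereal" where
  "F_star f \<psi> = (INF x\<in>edom \<psi>. F_obj f \<psi> x)"

text \<open>The arguments \<open>x\<close>, \<open>xb\<close>, \<open>vb\<close>, \<open>\<xi>\<close>, \<open>\<gamma>\<close> are the sequences
  \<open>x\<^sub>k\<close>, \<open>\<bar>x\<^sub>k\<close>, \<open>\<bar>v\<^sub>k\<close>, \<open>\<xi>\<^sub>k\<close>, \<open>\<gamma>\<^sub>k\<close>;
  the values of \<open>xb\<close>, \<open>vb\<close>, \<open>\<xi>\<close> at \<open>0\<close> play no role.\<close>

definition contracting_tensor_method_II ::
  "nat \<Rightarrow> ('a::euclidean_space \<Rightarrow> real) \<Rightarrow> ('a \<Rightarrow> ereal) \<Rightarrow> real \<Rightarrow> (nat \<Rightarrow> real) \<Rightarrow> (nat \<Rightarrow> real) \<Rightarrow>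
     (nat \<Rightarrow> 'a) \<Rightarrow> (nat \<Rightarrow> 'a) \<Rightarrow> (nat \<Rightarrow> 'a) \<Rightarrow> bool" where
  "contracting_tensor_method_II p f \<psi> c \<gamma> \<xi> vb xb x \<longleftrightarrow>
     x 0 \<in> edom \<psi> \<and> 0 \<le> c \<and>
     (\<forall>k. 0 < \<gamma> k \<and> \<gamma> k \<le> 1 \<and>
          0 \<le> \<xi> (k + 1) \<and> \<xi> (k + 1) \<le> c * \<gamma> k ^ (p + 1) \<and>
          vb (k + 1) \<in> edom \<psi> \<and>
          xb (k + 1) = (1 - \<gamma> k) *\<^sub>R x k + \<gamma> k *\<^sub>R vb (k + 1) \<and>
          (\<forall>v\<in>edom \<psi>.
             ereal (frechet_derivative (taylor_poly p f (x k)) (at (xb (k + 1))) (v - vb (k + 1)))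
               + \<psi> v \<ge> \<psi> (vb (k + 1)) - ereal (1 / \<gamma> k * \<xi> (k + 1))) \<and>
          x (k + 1) = (if F_obj f \<psi> (xb (k + 1)) \<le> F_obj f \<psi> (x k) then xb (k + 1) else x k))"

definition A_coef :: "nat \<Rightarrow> nat \<Rightarrow> real" where
  "A_coef p k = (\<Prod>j=0..p. real (k + j))"

definition a_coef :: "nat \<Rightarrow> nat \<Rightarrow> real" where
  "a_coef p i = A_coef p i - A_coef p (i - 1)"

definition est_fun ::
  "nat \<Rightarrow> ('a::euclidean_space \<Rightarrow> real) \<Rightarrow> ('a \<Rightarrow> ereal) \<Rightarrow> (nat \<Rightarrow> 'a) \<Rightarrow> nat \<Rightarrow> 'a \<Rightarrow> ereal" where
  "est_fun p f \<psi> xb k v =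
     (\<Sum>i=1..k. ereal (a_coef p i) *
        (ereal (f (xb i) + frechet_derivative f (at (xb i)) (v - xb i)) + \<psi> v))"

definition certificate ::
  "nat \<Rightarrow> ('a::euclidean_space \<Rightarrow> real) \<Rightarrow> ('a \<Rightarrow> ereal) \<Rightarrow> (nat \<Rightarrow> 'a) \<Rightarrow> (nat \<Rightarrow> 'a) \<Rightarrow> nat \<Rightarrow> ereal" where
  "certificate p f \<psi> xb x k =
     F_obj f \<psi> (x k) - ereal (1 / A_coef p k) * (INF v\<in>edom \<psi>. est_fun p f \<psi> xb k v)"

text \<open>The minima in \<open>F_star\<close> and \<open>certificate\<close> are written as infima in the complete lattice
  of extended reals. Under the standing assumptions these infima are indeed minima.\<close>

lemma edom_real:
  assumes "proper_closed_convex \<psi>" "v \<in> edom \<psi>"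
  obtains r where "\<psi> v = ereal r"
  using assms unfolding proper_closed_convex_def edom_def
  by (cases "\<psi> v") auto

lemma composite_min_attained:
  fixes \<psi> :: "'a::euclidean_space \<Rightarrow> ereal" and h :: "'a \<Rightarrow> real"
  assumes psi: "proper_closed_convex \<psi>" and bdd: "bounded (edom \<psi>)"
    and cont: "continuous_on (edom \<psi>) h" and below: "\<And>v. v \<in> edom \<psi> \<Longrightarrow> B \<le> h v"
  shows "\<exists>z\<in>edom \<psi>. \<forall>v\<in>edom \<psi>. ereal (h z) + \<psi> z \<le> ereal (h v) + \<psi> v"
proof -
  define g where "g = (\<lambda>v. ereal (h v) + \<psi> v)"
  define m where "m = (INF v\<in>edom \<psi>. g v)"
  have ne: "edom \<psi> \<noteq> {}" and cl: "closed (epi \<psi>)"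
    using psi by (auto simp: proper_closed_convex_def)
  then obtain v0 where v0: "v0 \<in> edom \<psi>" by blast
  obtain r0 where r0: "\<psi> v0 = ereal r0" using edom_real[OF psi v0] .
  have m_fin: "m < \<infinity>"
  proof -
    have "m \<le> g v0" unfolding m_def by (rule INF_lower[OF v0])
    also have "\<dots> < \<infinity>" by (simp add: g_def r0)
    finally show ?thesis .
  qed
  obtain u where u: "range u \<subseteq> g ` edom \<psi>" "decseq u" "Inf (g ` edom \<psi>) = (INF i. u i)"
    using Inf_countable_INF[of "g ` edom \<psi>"] ne by auto
  have lim_u: "u \<longlonglongrightarrow> m"
    using LIMSEQ_INF[OF u(2)] u(3) by (simp add: m_def)
  have "\<forall>n. \<exists>w\<in>edom \<psi>. u n = g w" using u(1) by (auto simp: image_iff subset_iff)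
  then obtain w where w: "\<And>n. w n \<in> edom \<psi>" "\<And>n. u n = g (w n)" by metis
  have "bounded (range w)" using bdd w(1) by (auto intro: bounded_subset)
  then obtain z s where s: "strict_mono (s :: nat \<Rightarrow> nat)" and zl: "(w \<circ> s) \<longlonglongrightarrow> z"
    using bounded_imp_convergent_subsequence[of w] by blast
  have lim_s: "(\<lambda>n. g (w (s n))) \<longlonglongrightarrow> m"
    using LIMSEQ_subseq_LIMSEQ[OF lim_u s] w(2) by (simp add: o_def)
  have in_epi: "(w (s n), r - h (w (s n))) \<in> epi \<psi>" if "g (w (s n)) < ereal r" for n r
  proof -
    obtain q where "\<psi> (w (s n)) = ereal q" using edom_real[OF psi w(1)] .
    with that show ?thesis by (simp add: g_def epi_def)
  qed
  have ev: "eventually (\<lambda>n. g (w (s n)) < ereal r) sequentially" if "m < ereal r" for r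
    using lim_s that by (rule order_tendstoD(2))
  have z_dom: "z \<in> edom \<psi>"
  proof -
    obtain r where r: "m < ereal r" using ereal_dense2[OF m_fin] by blast
    have "eventually (\<lambda>n. ((w \<circ> s) n, r - B) \<in> epi \<psi>) sequentially"
      using ev[OF r]
    proof eventually_elim
      case (elim n)
      have "\<psi> (w (s n)) \<le> ereal (r - h (w (s n)))" using in_epi[OF elim] by (simp add: epi_def)
      also have "\<dots> \<le> ereal (r - B)" using below[OF w(1)[of "s n"]] by simp
      finally show ?case by (simp add: epi_def)
    qed
    moreover have "(\<lambda>n. ((w \<circ> s) n, r - B)) \<longlonglongrightarrow> (z, r - B)"
      by (intro tendsto_Pair zl tendsto_const)
    ultimately have "(z, r - B) \<in> epi \<psi>"
      using cl by (intro Lim_in_closed_set[of "epi \<psi>" _ sequentially]) auto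
    then have "\<psi> z \<le> ereal (r - B)" by (simp add: epi_def)
    also have "\<dots> < \<infinity>" by simp
    finally show ?thesis by (simp add: edom_def)
  qed
  have lim_h: "(\<lambda>n. h ((w \<circ> s) n)) \<longlonglongrightarrow> h z"
    using cont z_dom w(1) zl by (intro continuous_on_tendsto_compose[OF cont zl]) auto
  have "g z \<le> ereal r" if "m < ereal r" for r
  proof -
    have "eventually (\<lambda>n. ((w \<circ> s) n, r - h ((w \<circ> s) n)) \<in> epi \<psi>) sequentially"
      using ev[OF that] by eventually_elim (use in_epi in auto)
    moreover have "(\<lambda>n. ((w \<circ> s) n, r - h ((w \<circ> s) n))) \<longlonglongrightarrow> (z, r - h z)"
      by (intro tendsto_Pair zl tendsto_diff tendsto_const lim_h)
    ultimately have "(z, r - h z) \<in> epi \<psi>"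
      using cl by (intro Lim_in_closed_set[of "epi \<psi>" _ sequentially]) auto
    moreover obtain q where "\<psi> z = ereal q" using edom_real[OF psi z_dom] .
    ultimately show ?thesis by (simp add: epi_def g_def le_diff_eq add.commute)
  qed
  then have "g z \<le> m"
    using ereal_dense2[of m "g z"] by (meson leD not_le_imp_less)
  then have "g z \<le> g v" if "v \<in> edom \<psi>" for v
    using INF_lower[OF that, of g] unfolding m_def by simp
  with z_dom show ?thesis by (auto simp: g_def)
qed

lemma cont_diff_at_differentiable:
  assumes "1 \<le> p" "cont_diff_at p f z"
  shows "f differentiable (at z)"
  using assms by (cases p) (auto simp: cont_diff_at_def)

lemma convex_above_tangent:
  fixes f :: "'a::euclidean_space \<Rightarrow> real"
  assumes cvx: "convex_on D f" and xy: "x \<in> D" "y \<in> D" and diff: "f differentiable (at x)"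
  shows "f x + frechet_derivative f (at x) (y - x) \<le> f y"
proof -
  let ?g = "\<lambda>t. f (x + t *\<^sub>R (y - x))"
  have *: "(f has_derivative frechet_derivative f (at x)) (at (x + 0 *\<^sub>R (y - x)))"
    using diff by (simp add: frechet_derivative_works)
  have "((\<lambda>t::real. x + t *\<^sub>R (y - x)) has_derivative (\<lambda>t. t *\<^sub>R (y - x))) (at 0)"
    by (auto intro!: derivative_eq_intros)
  from has_derivative_compose[OF this, of f "frechet_derivative f (at x)"] *
  have "(?g has_derivative (\<lambda>t. frechet_derivative f (at x) (t *\<^sub>R (y - x)))) (at 0)"
    by simp
  then have der: "(?g has_real_derivative frechet_derivative f (at x) (y - x)) (at 0)"
    using linear_frechet_derivative[OF diff]
    by (simp add: has_field_derivative_def linear_cmul mult_commute_abs)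
  have "((\<lambda>t. (?g t - ?g 0) / (t - 0)) \<longlongrightarrow> frechet_derivative f (at x) (y - x)) (at_right 0)"
    using has_field_derivative_iff[THEN iffD1, OF has_field_derivative_at_within[OF der, of "{0<..}"]]
    by simp
  moreover have "eventually (\<lambda>t. (?g t - ?g 0) / (t - 0) \<le> f y - f x) (at_right 0)"
    unfolding eventually_at_right_field
  proof (intro exI[of _ 1] conjI allI impI)
    fix t :: real assume t: "0 < t" "t < 1"
    have "x + t *\<^sub>R (y - x) = (1 - t) *\<^sub>R x + t *\<^sub>R y" by (simp add: algebra_simps)
    then have "?g t \<le> (1 - t) * f x + t * f y"
      using convex_onD[OF cvx, of t x y] t xy by simp
    then show "(?g t - ?g 0) / (t - 0) \<le> f y - f x"
      using t by (simp add: field_simps)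
  qed simp
  ultimately have "frechet_derivative f (at x) (y - x) \<le> f y - f x"
    by (rule tendsto_upperbound) simp
  then show ?thesis by simp
qed

lemma linear_bounded_below:
  fixes L :: "'a::euclidean_space \<Rightarrow> real"
  assumes "linear L" "bounded S"
  obtains B where "\<And>v. v \<in> S \<Longrightarrow> B \<le> L v"
proof -
  have "bounded (L ` S)"
    using assms by (intro bounded_linear_image) (auto simp: linear_linear)
  then obtain b where "\<And>v. v \<in> S \<Longrightarrow> \<bar>L v\<bar> \<le> b"
    by (auto simp: bounded_iff)
  then have "- b \<le> L v" if "v \<in> S" for v
    using that by (simp add: abs_le_iff minus_le_iff)
  then show ?thesis by (rule that)
qed

lemma F_star_attained:
  fixes f :: "'a::euclidean_space \<Rightarrow> real"
  assumes p: "1 \<le> p" and psi: "proper_closed_convex \<psi>" and bdd: "bounded (edom \<psi>)"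
    and sub: "edom \<psi> \<subseteq> D" and cvx: "convex_on D f" and smooth: "\<forall>z\<in>edom \<psi>. cont_diff_at p f z"
  shows "\<exists>z\<in>edom \<psi>. F_obj f \<psi> z = F_star f \<psi>"
proof -
  have diff: "f differentiable (at v)" if "v \<in> edom \<psi>" for v
    using cont_diff_at_differentiable p smooth that by blast
  then have cont: "continuous_on (edom \<psi>) f"
    by (meson continuous_at_imp_continuous_on differentiable_imp_continuous_within)
  obtain v0 where v0: "v0 \<in> edom \<psi>" using psi by (auto simp: proper_closed_convex_def)
  let ?L = "frechet_derivative f (at v0)"
  have lin: "linear ?L" using linear_frechet_derivative[OF diff[OF v0]] .
  obtain B where B: "\<And>v. v \<in> edom \<psi> \<Longrightarrow> B \<le> ?L v" using linear_bounded_below[OF lin bdd] by blast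
  have below: "f v0 - ?L v0 + B \<le> f v" if "v \<in> edom \<psi>" for v
  proof -
    have "v0 \<in> D" "v \<in> D" using that v0 sub by auto
    from convex_above_tangent[OF cvx this diff[OF v0]] B[OF that] show ?thesis
      by (simp add: linear_diff[OF lin])
  qed
  obtain z where z: "z \<in> edom \<psi>" "\<forall>v\<in>edom \<psi>. F_obj f \<psi> z \<le> F_obj f \<psi> v"
    using composite_min_attained[OF psi bdd cont below] by (auto simp: F_obj_def)
  then have "F_obj f \<psi> z = F_star f \<psi>"
    unfolding F_star_def by (intro antisym INF_greatest INF_lower) auto
  with z show ?thesis by blast
qed

lemma sum_a_coef: "(\<Sum>i=1..k. a_coef p i) = A_coef p k"
proof (induction k)
  case 0
  have "A_coef p 0 = 0" unfolding A_coef_def by (rule prod_zero) auto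
  then show ?case by simp
qed (simp add: a_coef_def)

lemma est_fun_min_attained:
  fixes f :: "'a::euclidean_space \<Rightarrow> real"
  assumes psi: "proper_closed_convex \<psi>" and bdd: "bounded (edom \<psi>)" and k: "1 \<le> k"
    and diff: "\<forall>i\<in>{1..k}. f differentiable (at (xb i))"
  shows "\<exists>z\<in>edom \<psi>. est_fun p f \<psi> xb k z = (INF v\<in>edom \<psi>. est_fun p f \<psi> xb k v)"
proof -
  let ?L = "\<lambda>i. frechet_derivative f (at (xb i))"
  define A where "A = A_coef p k"
  have A: "0 < A" using k by (auto simp: A_def A_coef_def intro!: prod_pos)
  define L where "L = (\<lambda>v. \<Sum>i=1..k. (a_coef p i / A) * ?L i v)"
  define C where "C = (\<Sum>i=1..k. (a_coef p i / A) * (f (xb i) - ?L i (xb i)))"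
  have lin: "linear (?L i)" if "i \<in> {1..k}" for i
    using diff that linear_frechet_derivative by blast
  have linL: "linear L"
    unfolding L_def by (intro linear_compose_sum ballI)
      (use lin in \<open>auto intro!: linearI simp: linear_add linear_cmul algebra_simps add_divide_distrib\<close>)
  obtain B where B: "\<And>v. v \<in> edom \<psi> \<Longrightarrow> B \<le> L v" using linear_bounded_below[OF linL bdd] by blast
  have cont: "continuous_on (edom \<psi>) (\<lambda>v. C + L v)"
    using linear_continuous_on[of L] linL by (intro continuous_intros) (auto simp: linear_linear)
  obtain z where z: "z \<in> edom \<psi>"
      "\<forall>v\<in>edom \<psi>. ereal (C + L z) + \<psi> z \<le> ereal (C + L v) + \<psi> v"
    using composite_min_attained[OF psi bdd cont, of "C + B"] B by auto
  have eq: "est_fun p f \<psi> xb k v = ereal A * (ereal (C + L v) + \<psi> v)" if v: "v \<in> edom \<psi>" for v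
  proof -
    obtain r where r: "\<psi> v = ereal r" using edom_real[OF psi v] .
    have 1: "A * C = (\<Sum>i=1..k. a_coef p i * (f (xb i) - ?L i (xb i)))"
      using A by (simp add: C_def sum_distrib_left)
    have 2: "A * L v = (\<Sum>i=1..k. a_coef p i * ?L i v)"
      using A by (simp add: L_def sum_distrib_left)
    have 3: "A * r = (\<Sum>i=1..k. a_coef p i * r)"
      by (simp add: A_def flip: sum_a_coef sum_distrib_right)
    have "A * (C + L v + r) = (\<Sum>i=1..k. a_coef p i * (f (xb i) + ?L i (v - xb i) + r))"
      unfolding distrib_left 1 2 3 sum.distrib[symmetric]
      by (intro sum.cong refl) (simp add: linear_diff[OF lin] algebra_simps)
    then show ?thesis by (simp add: est_fun_def r)
  qed
  have "est_fun p f \<psi> xb k z \<le> est_fun p f \<psi> xb k v" if "v \<in> edom \<psi>" for v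
    using z that A by (auto simp: eq intro!: ereal_mult_left_mono)
  then have "est_fun p f \<psi> xb k z = (INF v\<in>edom \<psi>. est_fun p f \<psi> xb k v)"
    using z by (intro antisym INF_greatest INF_lower) auto
  with z show ?thesis by blast
qed

end

theory Submission
  imports Defs
begin

text \<open>
  The estimating function satisfies \<open>\<phi>\<^sub>k \<ge> A\<^sub>k F(x\<^sub>k) - k (p+1)\<^sup>p\<^sup>+\<^sup>1 (c + \<Gamma>)\<close> by induction on \<open>k\<close>.
  In the inductive step, the Taylor polynomial may be replaced by \<open>f\<close> in the inexact optimality
  condition at the price \<open>\<gamma>\<^sub>k\<^sup>p \<Gamma>\<close>, convexity of \<open>f\<close> at the new point \<open>xb\<^sub>k\<^sub>+\<^sub>1\<close> and of \<open>\<psi>\<close> on the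
  segment from \<open>x\<^sub>k\<close> to \<open>vb\<^sub>k\<^sub>+\<^sub>1\<close> merges the old and new terms, and
  \<open>A\<^sub>k\<^sub>+\<^sub>1 \<gamma>\<^sub>k\<^sup>p\<^sup>+\<^sup>1 \<le> (p+1)\<^sup>p\<^sup>+\<^sup>1\<close> bounds the error.
\<close>

section \<open>Locality, linearity and homogeneity of iterated directional derivatives\<close>

text \<open>\<open>frechet_derivative\<close> is a choice among the derivatives at \<open>x\<close>,
  so it suffices that \<open>f\<close> and \<open>g\<close> have the same ones; points of
  non-differentiability are covered too.\<close>

lemma frechet_derivative_cong_open:
  fixes f g :: "'a::real_normed_vector \<Rightarrow> 'b::real_normed_vector"
  assumes "open U" "x \<in> U" "\<And>y. y \<in> U \<Longrightarrow> f y = g y"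
  shows "frechet_derivative f (at x) = frechet_derivative g (at x)"
proof -
  have "(f has_derivative f') (at x) \<longleftrightarrow> (g has_derivative f') (at x)" for f'
    using has_derivative_transform_within_open[of f f' x UNIV U g]
      has_derivative_transform_within_open[of g f' x UNIV U f] assms by metis
  then show ?thesis by (simp add: frechet_derivative_def)
qed

text \<open>Identities for the derivative of a function hold below only on the open set where it is
  smooth; this carries them under further derivatives.\<close>

lemma dir_deriv_cong_open:
  assumes "open U" "x \<in> U" "\<And>y. y \<in> U \<Longrightarrow> f y = g y"
  shows "dir_deriv i f x h = dir_deriv i g x h"
  using assms
proof (induction i arbitrary: f g)
  case (Suc i)
  have "frechet_derivative f (at y) h = frechet_derivative g (at y) h" if "y \<in> U" for y
    using frechet_derivative_cong_open[of U y f g] Suc.prems that by simp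
  then show ?case unfolding dir_deriv.simps by (intro Suc.IH[OF Suc.prems(1,2)])
qed simp

lemma cont_diff_on_mono:
  assumes "cont_diff_on n f U" "m \<le> n"
  shows "cont_diff_on m f U"
proof -
  \<comment> \<open>One order is dropped at a time; at the bottom, differentiability gives
    continuity.\<close>
  have step: "cont_diff_on (Suc n) f U \<Longrightarrow> cont_diff_on n f U" for n
  proof (induction n arbitrary: f)
    case 0
    then show ?case
      by (auto intro!: continuous_at_imp_continuous_on differentiable_imp_continuous_within)
  next
    case (Suc n)
    then have "\<forall>x\<in>U. f differentiable at x"
      and "cont_diff_on (Suc n) (\<lambda>x. frechet_derivative f (at x) h) U" for h
      by simp_all
    then show ?case using Suc.IH by (subst cont_diff_on.simps) blast
  qed
  from assms(2,1) show ?thesis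
    by (induction rule: inc_induct) (auto dest: step simp del: cont_diff_on.simps)
qed

lemma frechet_derivative_lincomb:
  fixes g :: "'b \<Rightarrow> 'a::real_normed_vector \<Rightarrow> real"
  assumes "finite B" "\<And>b. b \<in> B \<Longrightarrow> g b differentiable (at x)"
  shows "frechet_derivative (\<lambda>y. \<Sum>b\<in>B. w b * g b y) (at x) h
       = (\<Sum>b\<in>B. w b * frechet_derivative (g b) (at x) h)"
proof -
  have "((\<lambda>y. \<Sum>b\<in>B. w b * g b y) has_derivative
          (\<lambda>h. \<Sum>b\<in>B. w b * frechet_derivative (g b) (at x) h)) (at x)"
    using assms by (intro has_derivative_sum has_derivative_mult_right)
      (simp add: frechet_derivative_works[symmetric])
  from fun_cong[OF frechet_derivative_at[OF this], of h] show ?thesis by (rule sym)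
qed

text \<open>The weights do not depend on the point, so each derivative passes through the sum on all
  of \<open>U\<close>.\<close>

lemma dir_deriv_lincomb:
  fixes g :: "'b \<Rightarrow> 'a::euclidean_space \<Rightarrow> real"
  assumes "open U" "x \<in> U" "finite B" "\<And>b. b \<in> B \<Longrightarrow> cont_diff_on i (g b) U"
  shows "dir_deriv i (\<lambda>y. \<Sum>b\<in>B. w b * g b y) x h = (\<Sum>b\<in>B. w b * dir_deriv i (g b) x h)"
  using assms
proof (induction i arbitrary: g)
  case (Suc i)
  have "dir_deriv (Suc i) (\<lambda>y. \<Sum>b\<in>B. w b * g b y) x h =
    dir_deriv i (\<lambda>y. \<Sum>b\<in>B. w b * frechet_derivative (g b) (at y) h) x h"
    unfolding dir_deriv.simps using Suc.prems
    by (intro dir_deriv_cong_open[of U] frechet_derivative_lincomb) auto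
  also have "\<dots> = (\<Sum>b\<in>B. w b * dir_deriv i (\<lambda>y. frechet_derivative (g b) (at y) h) x h)"
    using Suc.prems by (intro Suc.IH) auto
  finally show ?case by simp
qed simp

text \<open>Iterated, this exhibits the directional derivative as a homogeneous polynomial in \<open>h\<close>.\<close>

lemma dir_deriv_Suc_Basis:
  fixes f :: "'a::euclidean_space \<Rightarrow> real"
  assumes U: "open U" "x \<in> U" and f: "cont_diff_on (Suc i) f U"
  shows "dir_deriv (Suc i) f x h
       = (\<Sum>b\<in>Basis. (h \<bullet> b) * dir_deriv i (\<lambda>y. frechet_derivative f (at y) b) x h)"
proof -
  have "frechet_derivative f (at y) h = (\<Sum>b\<in>Basis. (h \<bullet> b) * frechet_derivative f (at y) b)"
    if "y \<in> U" for y
  proof -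
    have "linear (frechet_derivative f (at y))"
      using f that linear_frechet_derivative by auto
    then have "frechet_derivative f (at y) (\<Sum>b\<in>Basis. (h \<bullet> b) *\<^sub>R b)
      = (\<Sum>b\<in>Basis. (h \<bullet> b) * frechet_derivative f (at y) b)"
      by (simp add: linear_sum linear_cmul)
    then show ?thesis by (simp add: euclidean_representation)
  qed
  then have "dir_deriv (Suc i) f x h
    = dir_deriv i (\<lambda>y. \<Sum>b\<in>Basis. (h \<bullet> b) * frechet_derivative f (at y) b) x h"
    unfolding dir_deriv.simps by (intro dir_deriv_cong_open[OF U])
  also have "\<dots> = (\<Sum>b\<in>Basis. (h \<bullet> b) * dir_deriv i (\<lambda>y. frechet_derivative f (at y) b) x h)"
    using f by (intro dir_deriv_lincomb[OF U]) auto
  finally show ?thesis .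
qed

text \<open>In coordinates of \<open>h\<close> the function is a sum of products of a coordinate
  with a derivative of lower order, hence the induction. This gives meaning to the gradient in
  \<open>h\<close> that defines \<open>dual_deriv\<close>.\<close>

lemma dir_deriv_differentiable:
  fixes f :: "'a::euclidean_space \<Rightarrow> real"
  assumes U: "open U" "x \<in> U" and "cont_diff_on i f U"
  shows "dir_deriv i f x differentiable (at h)"
  using assms(3)
proof (induction i arbitrary: f)
  case 0
  have "dir_deriv 0 f x = (\<lambda>h. f x)" by auto
  then show ?case by simp
next
  case (Suc i)
  have "dir_deriv (Suc i) f x =
    (\<lambda>h. \<Sum>b\<in>Basis. (h \<bullet> b) * dir_deriv i (\<lambda>y. frechet_derivative f (at y) b) x h)"
    by (rule ext) (rule dir_deriv_Suc_Basis[OF U Suc.prems])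
  moreover have "dir_deriv i (\<lambda>y. frechet_derivative f (at y) b) x differentiable (at h)" for b
    using Suc by simp
  moreover have "(\<lambda>h. h \<bullet> b) differentiable (at h)" for b :: 'a
    by (intro bounded_linear_imp_differentiable bounded_linear_inner_left)
  ultimately show ?case by (simp add: differentiable_sum differentiable_mult)
qed

text \<open>Each coordinate expansion contributes one factor \<open>t\<close>.\<close>

lemma dir_deriv_scaleR:
  fixes f :: "'a::euclidean_space \<Rightarrow> real"
  assumes U: "open U" "x \<in> U" and "cont_diff_on i f U"
  shows "dir_deriv i f x (t *\<^sub>R h) = t ^ i * dir_deriv i f x h"
  using assms(3)
proof (induction i arbitrary: f)
  case (Suc i)
  then have "dir_deriv i (\<lambda>y. frechet_derivative f (at y) b) x (t *\<^sub>R h)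
    = t ^ i * dir_deriv i (\<lambda>y. frechet_derivative f (at y) b) x h" for b
    by simp
  then show ?case
    unfolding dir_deriv_Suc_Basis[OF U Suc.prems]
    by (simp add: sum_distrib_left mult.assoc mult.left_commute)
qed simp

text \<open>The homogeneity identity is differentiated in \<open>h\<close> in two ways, by the chain
  rule and as a constant multiple; cancelling one \<open>t\<close> leaves the power
  \<open>i - 1\<close>.\<close>

lemma dual_deriv_scaleR:
  fixes f :: "'a::euclidean_space \<Rightarrow> real"
  assumes U: "open U" "x \<in> U" and f: "cont_diff_on i f U" and i: "1 \<le> i" and t: "t \<noteq> 0"
  shows "dual_deriv i f x (t *\<^sub>R h) u = t ^ (i - 1) * dual_deriv i f x h u"
proof -
  let ?g = "dir_deriv i f x"
  have d: "(?g has_derivative frechet_derivative ?g (at z)) (at z)" for z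
    using dir_deriv_differentiable[OF U f] by (simp add: frechet_derivative_works)
  have "((\<lambda>h. t *\<^sub>R h) has_derivative (\<lambda>h. t *\<^sub>R h)) (at h)"
    by (auto intro!: derivative_eq_intros)
  from has_derivative_compose[OF this d]
  have "((\<lambda>h. ?g (t *\<^sub>R h)) has_derivative (\<lambda>u. frechet_derivative ?g (at (t *\<^sub>R h)) (t *\<^sub>R u))) (at h)" .
  moreover have "((\<lambda>h. ?g (t *\<^sub>R h)) has_derivative (\<lambda>u. t ^ i * frechet_derivative ?g (at h) u)) (at h)"
    unfolding dir_deriv_scaleR[OF U f] by (intro has_derivative_mult_right d)
  ultimately have "frechet_derivative ?g (at (t *\<^sub>R h)) (t *\<^sub>R u) = t ^ i * frechet_derivative ?g (at h) u"
    using has_derivative_unique by metis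
  moreover have "frechet_derivative ?g (at (t *\<^sub>R h)) (t *\<^sub>R u) = t * frechet_derivative ?g (at (t *\<^sub>R h)) u"
    using linear_frechet_derivative[OF dir_deriv_differentiable[OF U f]] by (simp add: linear_cmul)
  moreover have "t ^ i = t * t ^ (i - 1)" using i by (cases i) auto
  ultimately have "frechet_derivative ?g (at (t *\<^sub>R h)) u = t ^ (i - 1) * frechet_derivative ?g (at h) u"
    using t by simp
  then show ?thesis by (simp add: dual_deriv_def)
qed

section \<open>The gradient of the Taylor polynomial and its error
  \<open>Gamma_const\<close>\<close>

text \<open>The factor \<open>1 / real i\<close> in \<open>dual_deriv\<close> turns
  \<open>1 / fact i\<close> into \<open>1 / fact (i - 1)\<close>, and homogeneity extracts
  \<open>t ^ (i - 1)\<close>. The result has the shape of the terms subtracted in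
  \<open>Gamma_const\<close>.\<close>

lemma taylor_poly_has_derivative:
  fixes f :: "'a::euclidean_space \<Rightarrow> real"
  assumes p: "1 \<le> p" and f: "cont_diff_at p f x" and t: "t \<noteq> 0"
  shows "(taylor_poly p f x has_derivative
     (\<lambda>u. frechet_derivative f (at x) u + (\<Sum>i=2..p. t ^ (i - 1) / fact (i - 1) * dual_deriv i f x h u)))
     (at (x + t *\<^sub>R h))" (is "(_ has_derivative ?T) _")
proof -
  obtain U where U: "open U" "x \<in> U" and fU: "cont_diff_on p f U"
    using f by (auto simp: cont_diff_at_def)
  have fi: "cont_diff_on i f U" if "i \<in> {1..p}" for i
    using cont_diff_on_mono[OF fU] that by simp
  have "((\<lambda>y. dir_deriv i f x (y - x)) has_derivative
      frechet_derivative (dir_deriv i f x) (at (t *\<^sub>R h))) (at (x + t *\<^sub>R h))" if "i \<in> {1..p}" for i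
  proof -
    have "((\<lambda>y. y - x) has_derivative (\<lambda>y. y)) (at (x + t *\<^sub>R h))"
      by (auto intro!: derivative_eq_intros)
    moreover have "(dir_deriv i f x has_derivative frechet_derivative (dir_deriv i f x) (at (t *\<^sub>R h)))
        (at (x + t *\<^sub>R h - x))"
      using dir_deriv_differentiable[OF U fi[OF that]] by (simp add: frechet_derivative_works)
    ultimately show ?thesis by (rule has_derivative_compose)
  qed
  then have der: "(taylor_poly p f x has_derivative
      (\<lambda>u. 0 + (\<Sum>i=1..p. 1 / fact i * frechet_derivative (dir_deriv i f x) (at (t *\<^sub>R h)) u)))
      (at (x + t *\<^sub>R h))"
    unfolding taylor_poly_def[abs_def]
    by (intro has_derivative_add has_derivative_const has_derivative_sum has_derivative_mult_right)
  have "(\<Sum>i=1..p. 1 / fact i * frechet_derivative (dir_deriv i f x) (at (t *\<^sub>R h)) u) = ?T u" for u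
  proof -
    have "(\<Sum>i=1..p. 1 / fact i * frechet_derivative (dir_deriv i f x) (at (t *\<^sub>R h)) u)
      = (\<Sum>i=1..p. t ^ (i - 1) / fact (i - 1) * dual_deriv i f x h u)"
    proof (intro sum.cong refl)
      fix i assume i: "i \<in> {1..p}"
      then have "fact i = real i * fact (i - 1)" by (cases i) auto
      then have "1 / fact i * frechet_derivative (dir_deriv i f x) (at (t *\<^sub>R h)) u
        = 1 / fact (i - 1) * dual_deriv i f x (t *\<^sub>R h) u"
        by (simp add: dual_deriv_def)
      then show "1 / fact i * frechet_derivative (dir_deriv i f x) (at (t *\<^sub>R h)) u
        = t ^ (i - 1) / fact (i - 1) * dual_deriv i f x h u"
        using i dual_deriv_scaleR[OF U fi[OF i] _ t] by simp
    qed
    also have "\<dots> = dual_deriv 1 f x h u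
        + (\<Sum>i=2..p. t ^ (i - 1) / fact (i - 1) * dual_deriv i f x h u)"
      using p by (simp add: sum.atLeast_Suc_atMost numeral_2_eq_2)
    \<comment> \<open>The first directional derivative is linear in the direction, so it is its own
      derivative.\<close>
    also have "dual_deriv 1 f x h u = frechet_derivative f (at x) u"
    proof -
      have "f differentiable (at x)" by (rule cont_diff_at_differentiable[OF p f])
      then have "(frechet_derivative f (at x) has_derivative frechet_derivative f (at x)) (at h)"
        by (intro bounded_linear_imp_has_derivative) (simp add: linear_frechet_derivative linear_linear)
      from frechet_derivative_at[OF this] show ?thesis by (simp add: dual_deriv_def)
    qed
    finally show ?thesis .
  qed
  with der show ?thesis by simp
qed

lemma frechet_derivative_taylor_poly:
  fixes f :: "'a::euclidean_space \<Rightarrow> real"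
  assumes "1 \<le> p" "cont_diff_at p f x" "t \<noteq> 0"
  shows "frechet_derivative (taylor_poly p f x) (at (x + t *\<^sub>R h)) u
       = frechet_derivative f (at x) u + (\<Sum>i=2..p. t ^ (i - 1) / fact (i - 1) * dual_deriv i f x h u)"
  by (simp flip: frechet_derivative_at[OF taylor_poly_has_derivative[OF assms]])

text \<open>All members of the supremum are absolute values, so one point of \<open>Q\<close>
  suffices; over an empty \<open>Q\<close> the supremum would be -\<infinity>.\<close>

lemma Gamma_const_nonneg:
  assumes "z \<in> Q"
  shows "0 \<le> Gamma_const p Q f"
  unfolding Gamma_const_def
  by (rule SUP_upper2[of "(z, z, z, 1)"]) (use assms in auto)

text \<open>The difference is the one inside the supremum at \<open>(x, y, v, t)\<close>, with the
  Taylor gradient written out.\<close>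

lemma Gamma_const_taylor_bound:
  fixes f :: "'a::euclidean_space \<Rightarrow> real"
  assumes p: "1 \<le> p" and f: "cont_diff_at p f x" and Q: "x \<in> Q" "y \<in> Q" "v \<in> Q"
    and t: "0 < t" "t \<le> 1" and G: "Gamma_const p Q f = ereal G"
  shows "\<bar>frechet_derivative f (at (x + t *\<^sub>R (v - x))) (v - y)
          - frechet_derivative (taylor_poly p f x) (at (x + t *\<^sub>R (v - x))) (v - y)\<bar> \<le> t ^ p * G"
    (is "\<bar>?d\<bar> \<le> _")
proof -
  have "ereal ((1 / t ^ p) * \<bar>?d\<bar>) \<le> Gamma_const p Q f"
    unfolding Gamma_const_def
    by (rule SUP_upper2[of "(x, y, v, t)"])
      (use Q t in \<open>auto simp: frechet_derivative_taylor_poly[OF p f] diff_diff_eq\<close>)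
  then show ?thesis using t by (simp add: G divide_simps mult.commute)
qed

section \<open>The coefficients \<open>A_coef\<close>\<close>

lemma A_coef_pos: "1 \<le> k \<Longrightarrow> 0 < A_coef p k"
  by (auto simp: A_coef_def intro!: prod_pos)

lemma A_coef_0: "A_coef p 0 = 0"
  unfolding A_coef_def by (rule prod_zero) auto

text \<open>Both products share the factors from \<open>k + 1\<close> to \<open>k + p\<close>. The
  cross-multiplied form also covers \<open>k = 0\<close>, where \<open>A_coef p 0\<close>
  vanishes.\<close>

lemma A_coef_Suc_mult: "A_coef p (Suc k) * real k = A_coef p k * (real k + real p + 1)"
proof -
  have "A_coef p k = real k * (\<Prod>j=1..p. real (k + j))"
    unfolding A_coef_def by (subst prod.atLeast_Suc_atMost) auto
  moreover have "A_coef p (Suc k) = (\<Prod>j=1..Suc p. real (k + j))"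
    unfolding A_coef_def
    using prod.shift_bounds_cl_Suc_ivl[of "\<lambda>j. real (k + j)" 0 p] by simp
  ultimately show ?thesis by (simp add: algebra_simps)
qed

lemma A_coef_ratio:
  "(A_coef p (k + 1) - A_coef p k) / A_coef p (k + 1) = (real p + 1) / (real k + real p + 1)"
proof -
  have "0 < A_coef p (k + 1)" by (simp add: A_coef_pos)
  moreover have "0 < real k + real p + 1" by simp
  ultimately show ?thesis using A_coef_Suc_mult[of p k]
    by (simp add: divide_simps del: of_nat_Suc) (simp add: algebra_simps)
qed

lemma A_coef_upper: "A_coef p k \<le> (real k + real p) ^ (p + 1)"
proof -
  have "A_coef p k \<le> (\<Prod>j=0..p. real k + real p)"
    unfolding A_coef_def by (intro prod_mono) auto
  then show ?thesis by simp
qed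

lemma A_coef_lower: "real k ^ (p + 1) \<le> A_coef p k"
proof -
  have "(\<Prod>j=0..p. real k) \<le> A_coef p k"
    unfolding A_coef_def by (intro prod_mono) auto
  then show ?thesis by simp
qed

text \<open>Jensen's inequality, read off from the convex combination of two points of the
  epigraph.\<close>

lemma proper_closed_convex_comb:
  assumes psi: "proper_closed_convex \<psi>" and t: "0 \<le> t" "t \<le> 1"
    and x: "\<psi> x = ereal r" and y: "\<psi> y = ereal s"
  shows "\<psi> ((1 - t) *\<^sub>R x + t *\<^sub>R y) \<le> ereal ((1 - t) * r + t * s)"
proof -
  have "convex (epi \<psi>)" using psi by (simp add: proper_closed_convex_def)
  then have "(1 - t) *\<^sub>R (x, r) + t *\<^sub>R (y, s) \<in> epi \<psi>"
    using t x y by (intro convexD) (auto simp: epi_def)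
  then show ?thesis by (simp add: epi_def)
qed

lemma est_fun_real:
  assumes "\<psi> v = ereal r"
  shows "est_fun p f \<psi> xb k v
    = ereal (\<Sum>i=1..k. a_coef p i * (f (xb i) + frechet_derivative f (at (xb i)) (v - xb i) + r))"
  by (simp add: est_fun_def assms)

theorem theorem6:
  fixes f :: "'a::euclidean_space \<Rightarrow> real"
    and D :: "'a set"
    and \<psi> :: "'a \<Rightarrow> ereal"
    and p :: nat and c :: real
    and \<gamma> \<xi> :: "nat \<Rightarrow> real"
    and x xb vb :: "nat \<Rightarrow> 'a"
  assumes p: "1 \<le> p"
    and psi: "proper_closed_convex \<psi>"
    and bdd: "bounded (edom \<psi>)"
    and f_dom: "edom \<psi> \<subseteq> D"
    and f_convex: "convex_on D f"
    and f_smooth: "\<forall>z\<in>edom \<psi>. cont_diff_at p f z"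
    and gamma: "\<forall>k. \<gamma> k = (A_coef p (k + 1) - A_coef p k) / A_coef p (k + 1)"
    and iterates: "contracting_tensor_method_II p f \<psi> c \<gamma> \<xi> vb xb x"
  shows "(\<forall>k. \<gamma> k = (real p + 1) / (real k + real p + 1)) \<and>
    (\<forall>k\<ge>1. F_obj f \<psi> (x k) - F_star f \<psi> \<le> certificate p f \<psi> xb x k \<and>
      certificate p f \<psi> xb x k
        \<le> ereal ((real p + 1) ^ (p + 1)) * (ereal c + Gamma_const p (edom \<psi>) f)
            * ereal (real k powi (- int p)))"
proof -
  let ?Q = "edom \<psi>" and ?G = "Gamma_const p (edom \<psi>) f" and ?K = "(real p + 1) ^ (p + 1)"
  let ?df = "\<lambda>z. frechet_derivative f (at z)"
  \<comment> \<open>On the domain \<psi> is finite; \<open>r\<close> lets the estimates run in the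
    reals.\<close>
  define r where "r v = real_of_ereal (\<psi> v)" for v
  have r: "\<psi> v = ereal (r v)" if "v \<in> ?Q" for v
    using edom_real[OF psi that] by (metis r_def real_of_ereal.simps(1))
  have F: "F_obj f \<psi> v = ereal (f v + r v)" if "v \<in> ?Q" for v
    using r[OF that] by (simp add: F_obj_def)
  have diff: "f differentiable (at v)" if "v \<in> ?Q" for v
    using cont_diff_at_differentiable[OF p] f_smooth that by blast
  have tangent: "f u + ?df u (v - u) \<le> f v" if "u \<in> ?Q" "v \<in> ?Q" for u v
    using convex_above_tangent[OF f_convex _ _ diff[OF that(1)]] that f_dom by blast
  note it = iterates[unfolded contracting_tensor_method_II_def]
  have c: "0 \<le> c" and g0: "0 < \<gamma> k" and g1: "\<gamma> k \<le> 1" and vb: "vb (Suc k) \<in> ?Q"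
    and xb: "xb (Suc k) = (1 - \<gamma> k) *\<^sub>R x k + \<gamma> k *\<^sub>R vb (Suc k)"
    and xi: "\<xi> (Suc k) \<le> c * \<gamma> k ^ (p + 1)"
    and step: "x (Suc k) = (if F_obj f \<psi> (xb (Suc k)) \<le> F_obj f \<psi> (x k) then xb (Suc k) else x k)" for k
    using it by auto
  have opt: "\<psi> (vb (Suc k)) - ereal (1 / \<gamma> k * \<xi> (Suc k))
      \<le> ereal (frechet_derivative (taylor_poly p f (x k)) (at (xb (Suc k))) (v - vb (Suc k))) + \<psi> v"
    if "v \<in> ?Q" for v k
    using it that unfolding Suc_eq_plus1 by blast
  have gam: "\<gamma> k = (real p + 1) / (real k + real p + 1)" for k
    using gamma A_coef_ratio by simp
  have psi_comb: "\<psi> (xb (Suc k)) \<le> ereal ((1 - \<gamma> k) * r (x k) + \<gamma> k * r (vb (Suc k)))"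
    if "x k \<in> ?Q" for k
    unfolding xb using less_imp_le[OF g0] g1 by (intro proper_closed_convex_comb[OF psi] r that vb)
  then have xb_dom': "xb (Suc k) \<in> ?Q" if "x k \<in> ?Q" for k
    using psi_comb[OF that] by (auto simp: edom_def)
  have x_dom: "x k \<in> ?Q" for k
  proof (induction k)
    case 0 then show ?case using it by simp
  next
    case (Suc k) then show ?case using xb_dom' by (simp add: step)
  qed
  have xb_dom: "xb (Suc k) \<in> ?Q" for k using xb_dom'[OF x_dom] .
  define est where
    "est k v = (\<Sum>i=1..k. a_coef p i * (f (xb i) + ?df (xb i) (v - xb i) + r v))" for k v
  have est: "est_fun p f \<psi> xb k v = ereal (est k v)" if "v \<in> ?Q" for k v
    using est_fun_real[of \<psi> v "r v"] r[OF that] by (simp add: est_def)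
  \<comment> \<open>The choice of \<gamma> in multiplied form: \<open>A_coef p k\<close> and
    \<open>a_coef p (Suc k)\<close> are the weights \<open>1 - \<gamma> k\<close> and
    \<open>\<gamma> k\<close> scaled by \<open>A_coef p (Suc k)\<close>.\<close>
  have aS: "a_coef p (Suc k) = \<gamma> k * A_coef p (Suc k)"
    and AS: "A_coef p k = (1 - \<gamma> k) * A_coef p (Suc k)" for k
    using gamma A_coef_pos[of "Suc k" p] by (simp_all add: a_coef_def field_simps)
  have Apos: "0 < A_coef p (Suc k)" for k by (simp add: A_coef_pos)
  have a_nonneg: "0 \<le> a_coef p i" if "i \<in> {1..k}" for i k
    using that aS[of "i - 1"] g0[of "i - 1"] Apos[of "i - 1"] by simp
  \<comment> \<open>Tangents of a convex function lie below it, and the weights sum to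
    \<open>A_coef p k\<close>.\<close>
  have est_upper: "est k v \<le> A_coef p k * (f v + r v)" if "v \<in> ?Q" for k v
  proof -
    have "est k v \<le> (\<Sum>i=1..k. a_coef p i * (f v + r v))"
      unfolding est_def
    proof (intro sum_mono mult_left_mono)
      fix i assume i: "i \<in> {1..k}"
      then have "xb i \<in> ?Q" using xb_dom[of "i - 1"] by simp
      then show "f (xb i) + ?df (xb i) (v - xb i) + r v \<le> f v + r v"
        using tangent that by simp
    qed (use a_nonneg in blast)
    also have "\<dots> = A_coef p k * (f v + r v)"
      by (simp only: sum_a_coef flip: sum_distrib_right)
    finally show ?thesis .
  qed
  have cert: "\<exists>z\<in>?Q. certificate p f \<psi> xb x k = ereal (f (x k) + r (x k) - est k z / A_coef p k)"
    if k: "1 \<le> k" for k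
  proof -
    have "\<forall>i\<in>{1..k}. f differentiable (at (xb i))"
    proof
      fix i assume "i \<in> {1..k}"
      then show "f differentiable (at (xb i))" using diff[OF xb_dom[of "i - 1"]] by simp
    qed
    from est_fun_min_attained[OF psi bdd k this]
    obtain z where z: "z \<in> ?Q" "est_fun p f \<psi> xb k z = (INF v\<in>?Q. est_fun p f \<psi> xb k v)" by blast
    then have "certificate p f \<psi> xb x k = ereal (f (x k) + r (x k) - est k z / A_coef p k)"
      unfolding certificate_def z(2)[symmetric] by (simp add: F[OF x_dom] est)
    with z(1) show ?thesis by blast
  qed
  \<comment> \<open>Evaluating the estimating function at a minimizer \<open>z\<close> of
    \<open>F\<close> bounds its scaled minimum by \<open>F_star\<close>.\<close>
  have lower: "F_obj f \<psi> (x k) - F_star f \<psi> \<le> certificate p f \<psi> xb x k" if k: "1 \<le> k" for k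
  proof -
    have Ak: "0 < A_coef p k" by (rule A_coef_pos[OF k])
    obtain z where z: "z \<in> ?Q" "F_obj f \<psi> z = F_star f \<psi>"
      using F_star_attained[OF p psi bdd f_dom f_convex f_smooth] by blast
    have "(INF v\<in>?Q. est_fun p f \<psi> xb k v) \<le> ereal (est k z)"
      using INF_lower[OF z(1), of "est_fun p f \<psi> xb k"] est[OF z(1)] by simp
    then have "ereal (1 / A_coef p k) * (INF v\<in>?Q. est_fun p f \<psi> xb k v)
        \<le> ereal (1 / A_coef p k) * ereal (est k z)"
      using Ak by (intro ereal_mult_left_mono) auto
    also have "\<dots> \<le> F_star f \<psi>"
      using est_upper[OF z(1), of k] Ak by (simp add: z(2)[symmetric] F[OF z(1)] field_simps)
    finally show ?thesis unfolding certificate_def by (intro ereal_minus_mono) auto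
  qed
  have upper: "certificate p f \<psi> xb x k
      \<le> ereal ?K * (ereal c + ?G) * ereal (real k powi (- int p))" if k: "1 \<le> k" for k
  proof (cases "?G")
    case MInf
    then show ?thesis using Gamma_const_nonneg[OF x_dom, of p f] by simp
  next
    case PInf
    \<comment> \<open>The other two factors are positive, so the right-hand side is
      infinite.\<close>
    then show ?thesis using k by (simp add: add_nonneg_pos)
  next
    case (real G)
    have G: "0 \<le> G" using Gamma_const_nonneg[OF x_dom, of p f] real by simp
    \<comment> \<open>The inductive increment: each iteration loses at most
      \<open>(c + G) * ?K\<close>, independently of \<open>k\<close>.\<close>
    have est_step: "A_coef p k * (f (x k) + r (x k))
        + a_coef p (Suc k) * (f (xb (Suc k)) + ?df (xb (Suc k)) (v - xb (Suc k)) + r v)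
        \<ge> A_coef p (Suc k) * (f (x (Suc k)) + r (x (Suc k))) - (c + G) * ?K"
      if v: "v \<in> ?Q" for k v
    proof -
      let ?A = "A_coef p (Suc k)" and ?z = "xb (Suc k)" and ?w = "vb (Suc k)" and ?g = "\<gamma> k"
      have lin: "linear (?df ?z)" using linear_frechet_derivative[OF diff[OF xb_dom]] .
      have z: "?z = x k + ?g *\<^sub>R (?w - x k)" by (simp add: xb algebra_simps)
      have "r ?w - 1 / ?g * \<xi> (Suc k)
          \<le> frechet_derivative (taylor_poly p f (x k)) (at ?z) (v - ?w) + r v"
        using opt[OF v, of k] by (simp add: r[OF v] r[OF vb])
      \<comment> \<open>\<open>Gamma_const\<close> is used with \<open>t\<close> as
        \<open>\<gamma> k\<close>, its \<open>v\<close> as \<open>?w\<close> and its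
        \<open>y\<close> as \<open>v\<close>. The direction is thus opposite to that of the
        optimality condition, hence the two sign changes below.\<close>
      moreover have "\<bar>?df ?z (?w - v) - frechet_derivative (taylor_poly p f (x k)) (at ?z) (?w - v)\<bar>
          \<le> ?g ^ p * G"
        unfolding z using g0 g1 f_smooth x_dom v vb
        by (intro Gamma_const_taylor_bound[OF p _ _ _ _ _ _ real]) auto
      moreover have "?df ?z (?w - v) = - ?df ?z (v - ?w)"
        using linear_diff[OF lin] by simp
      moreover have "frechet_derivative (taylor_poly p f (x k)) (at ?z) (?w - v)
          = - frechet_derivative (taylor_poly p f (x k)) (at ?z) (v - ?w)"
      proof -
        have "cont_diff_at p f (x k)" "?g \<noteq> 0" using f_smooth x_dom g0[of k] by auto
        from taylor_poly_has_derivative[OF p this]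
        have "linear (frechet_derivative (taylor_poly p f (x k)) (at ?z))"
          unfolding z by (intro linear_frechet_derivative differentiableI)
        then show ?thesis by (simp add: linear_diff)
      qed
      \<comment> \<open>The division by \<gamma> costs one power, so the inexactness has the same
        order as the Taylor error.\<close>
      moreover have "1 / ?g * \<xi> (Suc k) \<le> c * ?g ^ p"
        using xi[of k] g0[of k] by (simp add: field_simps)
      ultimately have key: "r ?w - (c + G) * ?g ^ p \<le> ?df ?z (v - ?w) + r v"
        by (simp add: algebra_simps)
      have xk: "f ?z + ?df ?z (x k - ?z) \<le> f (x k)" using tangent[OF xb_dom x_dom] .
      \<comment> \<open>As \<open>?z\<close> is the combination of \<open>x k\<close> and
        \<open>?w\<close>, the tangent terms towards \<open>x k\<close> and \<open>v\<close> merge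
        into the direction controlled by \<open>key\<close>.\<close>
      have comb: "(1 - ?g) * ?df ?z (x k - ?z) + ?g * ?df ?z (v - ?z) = ?g * ?df ?z (v - ?w)"
      proof -
        have "(1 - ?g) *\<^sub>R (x k - ?z) + ?g *\<^sub>R (v - ?z) = ?g *\<^sub>R (v - ?w)"
          by (simp add: xb algebra_simps)
        from arg_cong[OF this, of "?df ?z"] show ?thesis
          by (simp only: linear_add[OF lin] linear_cmul[OF lin] real_scaleR_def)
      qed
      have rz: "r ?z \<le> (1 - ?g) * r (x k) + ?g * r ?w"
        using psi_comb[OF x_dom, of k] by (simp add: r[OF xb_dom])
      \<comment> \<open>Either branch of the monotone update does no worse than
        \<open>?z\<close>.\<close>
      have Fx: "f (x (Suc k)) + r (x (Suc k)) \<le> f ?z + r ?z"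
        using step[of k] by (auto simp: F[OF xb_dom] F[OF x_dom])
      \<comment> \<open>The \<open>p + 1\<close> factors of \<open>?A\<close> are at most
        \<open>real k + real p + 1\<close>, the denominator of \<open>\<gamma> k\<close>; only its
        numerator survives.\<close>
      have "?A * ?g ^ (p + 1) \<le> ?K"
      proof -
        have "?A * ?g ^ (p + 1) \<le> (real k + real p + 1) ^ (p + 1) * ?g ^ (p + 1)"
          using A_coef_upper[of p "Suc k"] g0[of k] by (intro mult_right_mono) (auto simp: add_ac)
        also have "\<dots> = ((real k + real p + 1) * ?g) ^ (p + 1)" by (simp only: power_mult_distrib)
        also have "(real k + real p + 1) * ?g = real p + 1"
          by (simp add: gam add_nonneg_eq_0_iff)
        finally show ?thesis .
      qed
      then have err: "(c + G) * (?A * ?g ^ (p + 1)) \<le> (c + G) * ?K"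
        using c G by (intro mult_left_mono) auto
      have 1: "(1 - ?g) * (f ?z + ?df ?z (x k - ?z)) \<le> (1 - ?g) * f (x k)"
        using xk g1[of k] by (intro mult_left_mono) auto
      have 2: "?g * (r ?w - (c + G) * ?g ^ p) \<le> ?g * (?df ?z (v - ?w) + r v)"
        using key g0[of k] by (intro mult_left_mono) auto
      \<comment> \<open>The tangent inequality enters with weight \<open>1 - ?g\<close> and
        \<open>key\<close> with weight \<open>?g\<close>, which raises the error to the power
        \<open>p + 1\<close>.\<close>
      have "f ?z + r ?z - (c + G) * ?g ^ (p + 1)
          \<le> (1 - ?g) * (f (x k) + r (x k)) + ?g * (f ?z + ?df ?z (v - ?z) + r v)"
        using 1 2 rz comb by (simp add: algebra_simps)
      with Fx have "f (x (Suc k)) + r (x (Suc k)) - (c + G) * ?g ^ (p + 1)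
          \<le> (1 - ?g) * (f (x k) + r (x k)) + ?g * (f ?z + ?df ?z (v - ?z) + r v)"
        by linarith
      from mult_left_mono[OF this less_imp_le[OF Apos[of k]]] err
      show ?thesis unfolding AS[of k] aS[of k] by (simp add: algebra_simps)
    qed
    \<comment> \<open>The increments are summed from \<open>k = 0\<close>, where both sides vanish
      because \<open>A_coef p 0\<close> is zero.\<close>
    have est_lower: "A_coef p k * (f (x k) + r (x k)) - real k * ((c + G) * ?K) \<le> est k v"
      if v: "v \<in> ?Q" for k v
    proof (induction k)
      case 0 then show ?case by (simp add: A_coef_0 est_def)
    next
      case (Suc k)
      have "est (Suc k) v = est k v
        + a_coef p (Suc k) * (f (xb (Suc k)) + ?df (xb (Suc k)) (v - xb (Suc k)) + r v)"
        by (simp add: est_def)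
      then show ?case using Suc.IH est_step[OF v, of k] by (simp add: distrib_right)
    qed
    obtain z where z: "z \<in> ?Q"
      and ce: "certificate p f \<psi> xb x k = ereal (f (x k) + r (x k) - est k z / A_coef p k)"
      using cert[OF k] by blast
    have Ak: "0 < A_coef p k" by (rule A_coef_pos[OF k])
    have "f (x k) + r (x k) - est k z / A_coef p k \<le> real k * ((c + G) * ?K) / A_coef p k"
      using divide_right_mono[OF est_lower[OF z, of k] less_imp_le[OF Ak]] Ak
      by (simp add: diff_divide_distrib)
    \<comment> \<open>The accumulated error grows like \<open>k\<close> while
      \<open>A_coef p k\<close> is at least \<open>real k ^ (p + 1)\<close>; the quotient gives the
      rate.\<close>
    also have "\<dots> \<le> real k * ((c + G) * ?K) / real k ^ (p + 1)"
      using A_coef_lower[of k p] k c G by (intro divide_left_mono) (auto intro!: mult_pos_pos Ak)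
    also have "\<dots> = ?K * (c + G) * real k powi (- int p)"
      using k by (simp add: power_int_minus field_simps)
    finally show ?thesis by (simp add: ce real)
  qed
  show ?thesis using gam lower upper by blast
qed

end
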